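(* Let $B\subseteq \mathbb{N}^+$ be an infinite set with increasing enumeration $(b_n: n \in \mathbb{N}^+)$ and suppose that there exists $q\in\mathbb{N}^+$ such that $$\liminf_{n\to \infty}\frac{b_{n+q}}{b_n}>1.$$ Then for each $\alpha \in [0,1]$ there exists a set $A\subseteq \mathbb{N}^+$ such that $\mathsf{d}(A)=0$ and $\mathsf{d}(A+B)=\alpha$.
   Context: $\mathbb{N}^+=\{1,2,\ldots\}$. For $S\subseteq \mathbb{N}^+$, the asymptotic density is $\mathsf{d}(S):=\lim_{n\to\infty} |S\cap[1,n]|/n$, provided the limit exists; "$\mathsf{d}(S)=\alpha$" means that the limit exists and equals $\alpha$. The sumset is $A+B:=\{x+y: x\in A, y\in B\}$. *)

theory Defs
  imports "HOL-Analysis.Analysis" "HOL-Library.Set_Algebras" "HOL-Library.Infinite_Set"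
begin

definition has_asymp_density :: "nat set \<Rightarrow> real \<Rightarrow> bool" where
  "has_asymp_density S \<alpha> \<longleftrightarrow>
     (\<lambda>n. real (card (S \<inter> {1..n})) / real n) \<longlonglongrightarrow> \<alpha>"

end

theory Submission
  imports Defs
begin

text \<open>
  The set \<open>A\<close> is built greedily: \<open>a\<close> is put into \<open>A\<close> iff the sumset built so far has fewer than
  \<open>\<alpha> a\<close> elements in \<open>{1..a}\<close> and, among the \<open>k\<close> elements \<open>b \<le> a\<close> of \<open>B\<close>, at least \<open>sqrt k\<close> give a new
  sum \<open>a + b\<close>. The sets of new sums are disjoint and their sizes tend to infinity, so \<open>A\<close> has
  density 0.

  The growth condition on \<open>B\<close> says that every window \<open>{n div d<..n}\<close> contains boundedly many
  elements of \<open>B\<close>. If \<open>m\<close> is the last point up to \<open>n\<close> where the sumset is too thin, then its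
  elements in \<open>{m<..n}\<close> are sums \<open>a + b\<close> with \<open>a \<le> m\<close>; either they lie within \<open>n div d\<close> of \<open>m\<close> or \<open>b\<close>
  is in the window, which leaves only \<open>O(card (A \<inter> {1..n})) = o(n)\<close> of them. If instead \<open>m\<close> is the last
  point up to \<open>n\<close> where the sumset is thick enough, then every \<open>a\<close> in \<open>{m<..n}\<close> outside \<open>A\<close> was rejected
  for having fewer than \<open>sqrt k\<close> new sums. Counting the pairs \<open>(x, b)\<close> with \<open>x\<close> uncovered and
  \<open>b \<le> n div d\<close> then shows that only \<open>o(n)\<close> elements of \<open>{m<..n}\<close> beyond \<open>m + 2 (n div d)\<close> are
  uncovered.
\<close>

section \<open>Density criterion and greedy recursion\<close>

lemma has_asymp_densityI:
  assumes "\<And>e. e > 0 \<Longrightarrow>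
    \<forall>\<^sub>F n in sequentially. \<bar>real (card (S \<inter> {1..n})) - \<alpha> * real n\<bar> \<le> e * real n"
  shows "has_asymp_density S \<alpha>"
  unfolding has_asymp_density_def tendsto_iff
proof (intro allI impI)
  fix e :: real
  assume "e > 0"
  then have "\<forall>\<^sub>F n in sequentially. \<bar>real (card (S \<inter> {1..n})) - \<alpha> * real n\<bar> \<le> e / 2 * real n"
    using assms[of "e / 2"] by simp
  then show "\<forall>\<^sub>F n in sequentially. dist (real (card (S \<inter> {1..n})) / real n) \<alpha> < e"
    using eventually_gt_at_top[of 0]
  proof eventually_elim
    case (elim n)
    have "real (card (S \<inter> {1..n})) / real n - \<alpha>
        = (real (card (S \<inter> {1..n})) - \<alpha> * real n) / real n"
      using elim(2) by (simp add: field_simps)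
    then have "dist (real (card (S \<inter> {1..n})) / real n) \<alpha>
        = \<bar>real (card (S \<inter> {1..n})) - \<alpha> * real n\<bar> / real n"
      by (simp add: dist_real_def)
    also have "\<dots> \<le> e / 2"
      using elim by (simp add: field_simps)
    finally show ?case using \<open>e > 0\<close> by simp
  qed
qed

text \<open>Course-of-values recursion: \<open>G n\<close> holds the members decided below
  \<open>n\<close>, so the decision at \<open>n\<close> may consult all earlier ones.\<close>

lemma greedy_set_exists:
  fixes P :: "nat set \<Rightarrow> nat \<Rightarrow> bool"
  shows "\<exists>A. \<forall>n. n \<in> A \<longleftrightarrow> P (A \<inter> {..<n}) n"
proof -
  define G where "G = rec_nat {} (\<lambda>n S. if P S n then insert n S else S)"
  define A where "A = {n. P (G n) n}"
  have "A \<inter> {..<n} = G n" for n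
  proof (induction n)
    case 0
    then show ?case by (simp add: G_def)
  next
    case (Suc n)
    have "A \<inter> {..<Suc n} = (A \<inter> {..<n}) \<union> (A \<inter> {n})" by auto
    also have "\<dots> = G (Suc n)" unfolding Suc by (auto simp: G_def A_def)
    finally show ?case .
  qed
  moreover have "n \<in> A \<longleftrightarrow> P (G n) n" for n by (simp add: A_def)
  ultimately have "\<forall>n. n \<in> A \<longleftrightarrow> P (A \<inter> {..<n}) n" by simp
  then show ?thesis ..
qed

section \<open>Counting elements of \<open>B\<close>\<close>

lemma filterlim_card_Int_atLeastAtMost:
  fixes B :: "nat set"
  assumes "B \<subseteq> {1..}" and "infinite B"
  shows "filterlim (\<lambda>n. card (B \<inter> {1..n})) at_top sequentially"
  unfolding filterlim_at_top
proof
  fix K :: nat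
  obtain F where F: "F \<subseteq> B" "finite F" "card F = K"
    using infinite_arbitrarily_large[OF assms(2)] by blast
  show "\<forall>\<^sub>F n in sequentially. K \<le> card (B \<inter> {1..n})"
    using eventually_ge_at_top[of "\<Sum>F"]
  proof eventually_elim
    case (elim n)
    have "x \<le> n" if "x \<in> F" for x
      using that F(2) elim member_le_sum[of x F id] by simp
    then have "F \<subseteq> B \<inter> {1..n}" using F(1) assms(1) by auto
    then show ?case using F(3) card_mono[of "B \<inter> {1..n}" F] by simp
  qed
qed

text \<open>Two elements of the window have ratio below \<open>d\<close>. Past \<open>n0\<close>,
  moving \<open>q\<close> indices multiplies \<open>b\<close> by more than \<open>c > 1\<close>, so
  \<open>j * q\<close> indices with \<open>c ^ j > d\<close> already leave the window. Indices below
  \<open>n0\<close> add at most \<open>n0\<close>.\<close>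

lemma card_window_bounded:
  fixes B :: "nat set"
  assumes B: "B \<subseteq> {1..}" "infinite B"
    and liminf: "liminf (\<lambda>n. ereal (real (enumerate B (n + q)) / real (enumerate B n))) > 1"
    and d: "d \<ge> 1"
  shows "\<exists>C. \<forall>n. card (B \<inter> {n div d<..n}) \<le> C"
proof -
  define b where "b = enumerate B"
  have b_pos: "b i > 0" for i
    using enumerate_in_set[OF B(2), of i] B(1) unfolding b_def by (auto simp: Suc_le_eq)
  have b_mono: "i \<le> j \<Longrightarrow> b i \<le> b j" for i j
    unfolding b_def using enumerate_mono_le_iff[OF B(2)] by simp
  obtain c :: real where c: "1 < c" and cl: "ereal c < liminf (\<lambda>n. ereal (real (b (n + q)) / real (b n)))"
    using ereal_dense2[OF liminf] unfolding b_def by auto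
  obtain n0 where n0: "\<And>n. n \<ge> n0 \<Longrightarrow> c * b n < b (n + q)"
    using less_LiminfD[OF cl] b_pos unfolding eventually_sequentially
    by (auto simp: field_simps)
  have pow: "c ^ j * b n \<le> b (n + j * q)" if "n \<ge> n0" for n j
  proof (induction j)
    case (Suc j)
    have "c ^ Suc j * b n \<le> c * b (n + j * q)"
      using Suc c by simp
    also have "\<dots> \<le> b (n + Suc j * q)"
      using n0[of "n + j * q"] that by (simp add: algebra_simps)
    finally show ?case .
  qed simp
  obtain j where j: "real d < c ^ j" using real_arch_pow[OF c] by blast
  have "card (B \<inter> {n div d<..n}) \<le> n0 + j * q" for n
  proof -
    define S where "S = {i. b i \<in> {n div d<..n}}"
    have BS: "B \<inter> {n div d<..n} = b ` S"
    proof -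
      have "B = range b" using range_enumerate[OF B(2)] by (simp add: b_def)
      then show ?thesis by (auto simp: S_def)
    qed
    have far: "i' < i + j * q" if "i \<in> S" "n0 \<le> i" "i' \<in> S" for i i'
    proof (rule ccontr)
      assume "\<not> i' < i + j * q"
      then have "b (i + j * q) \<le> b i'" by (intro b_mono) simp
      also have "\<dots> \<le> n" using that(3) by (simp add: S_def)
      also have "n < d * b i"
        using that(1) d by (simp add: S_def div_less_iff_less_mult mult.commute)
      finally have "real (b (i + j * q)) < real d * real (b i)"
        by (metis of_nat_less_iff of_nat_mult)
      also have "\<dots> \<le> c ^ j * real (b i)"
        using j by (intro mult_right_mono) auto
      also have "\<dots> \<le> b (i + j * q)" using pow[OF that(2)] .
      finally show False by simp
    qed
    obtain i0 where "S \<subseteq> {..<n0} \<union> {i0..<i0 + j * q}"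
    proof (cases "S \<subseteq> {..<n0}")
      case False
      define i0 where "i0 = (LEAST i. i \<in> S \<and> n0 \<le> i)"
      have "i0 \<in> S \<and> n0 \<le> i0"
        unfolding i0_def by (rule LeastI_ex) (use False in \<open>auto simp: not_less\<close>)
      moreover have "i0 \<le> i" if "i \<in> S" "n0 \<le> i" for i
        unfolding i0_def by (rule Least_le) (use that in simp)
      ultimately have "S \<subseteq> {..<n0} \<union> {i0..<i0 + j * q}"
        using far by (meson Un_iff atLeastLessThan_iff lessThan_iff not_less subsetI)
      then show ?thesis by (rule that)
    qed (use that in blast)
    then have "finite S" "card S \<le> card ({..<n0} \<union> {i0..<i0 + j * q})"
      by (rule finite_subset card_mono[rotated], simp)+
    then show ?thesis
      unfolding BS using card_image_le[of S b] card_Un_le[of "{..<n0}" "{i0..<i0 + j * q}"] by simp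
  qed
  then show ?thesis by blast
qed

lemma card_Int_split:
  fixes X :: "nat set"
  assumes "m \<le> n"
  shows "card (X \<inter> {1..n}) = card (X \<inter> {1..m}) + card (X \<inter> {m<..n})"
proof -
  have "X \<inter> {1..n} = (X \<inter> {1..m}) \<union> (X \<inter> {m<..n})" using assms by auto
  then show ?thesis by (simp add: card_Un_disjoint disjoint_iff)
qed

lemma card_set_plus_le:
  fixes A B :: "nat set"
  assumes "finite A" "finite B"
  shows "card (A + B) \<le> card A * card B"
  using card_image_le[of "A \<times> B" "\<lambda>(x, y). x + y"] assms
  by (simp add: set_plus_image card_cartesian_product)

section \<open>The greedy set\<close>

text \<open>Only the window bound is kept from the growth condition. The threshold sqrt k is written
  with a square, which keeps it in the naturals.\<close>

locale greedy =
  fixes A B :: "nat set" and \<alpha> :: real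
  assumes B_pos: "B \<subseteq> {1..}" and B_inf: "infinite B"
    and window: "\<And>d. d \<ge> 1 \<Longrightarrow> \<exists>C. \<forall>n. card (B \<inter> {n div d<..n}) \<le> C"
    and \<alpha>: "0 \<le> \<alpha>" "\<alpha> \<le> 1"
    and A_iff: "\<And>a. a \<in> A \<longleftrightarrow>
      real (card (((A \<inter> {..<a}) + B) \<inter> {1..a})) < \<alpha> * real a \<and>
      card (B \<inter> {1..a}) \<le> (card {b \<in> B. b \<le> a \<and> a + b \<notin> (A \<inter> {..<a}) + B})\<^sup>2"
begin

definition f where "f n = card ((A + B) \<inter> {1..n})"

definition k where "k n = card (B \<inter> {1..n})"

definition fresh where "fresh a = {b \<in> B. b \<le> a \<and> a + b \<notin> (A \<inter> {..<a}) + B}"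

lemma finite_fresh [simp]: "finite (fresh a)"
  by (rule finite_subset[of _ "{..a}"]) (auto simp: fresh_def)

text \<open>Elements of \<open>B\<close> are at least 1, so a sum not exceeding \<open>a\<close> has
  its first summand below \<open>a\<close>: up to \<open>a\<close>, the partial sumset is already
  final.\<close>

lemma mem_A_iff: "a \<in> A \<longleftrightarrow> real (f a) < \<alpha> * real a \<and> k a \<le> (card (fresh a))\<^sup>2"
proof -
  have "((A \<inter> {..<a}) + B) \<inter> {1..a} = (A + B) \<inter> {1..a}"
  proof (intro equalityI subsetI)
    fix x assume "x \<in> (A + B) \<inter> {1..a}"
    then obtain y z where "y \<in> A" "z \<in> B" "x = y + z" "x \<le> a" "x \<ge> 1"
      by (auto elim: set_plus_elim)
    moreover from this have "y < a" using B_pos by fastforce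
    ultimately show "x \<in> ((A \<inter> {..<a}) + B) \<inter> {1..a}" by auto
  qed (auto elim!: set_plus_elim)
  then show ?thesis using A_iff[of a] by (simp add: f_def k_def fresh_def)
qed

lemma A_pos: "A \<subseteq> {1..}"
  \<comment> \<open>At 0 the strict inequality would read 0 < 0.\<close>
  using mem_A_iff[of 0] by (auto simp: Suc_le_eq intro: gr0I)

lemma k_mono: "m \<le> n \<Longrightarrow> k m \<le> k n"
  unfolding k_def by (intro card_mono) auto

lemma k_at_top: "filterlim k at_top sequentially"
  using filterlim_card_Int_atLeastAtMost[OF B_pos B_inf] unfolding k_def .

section \<open>Density of \<open>A\<close>\<close>

text \<open>Each \<open>a\<close> in \<open>A\<close> beyond \<open>n0\<close> has at least
  \<open>T\<close> fresh sums. These are already covered when a later element is tested, so the sets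
  \<open>N a\<close> are disjoint, and they all lie in \<open>{1..2 * n}\<close>.\<close>

lemma card_A_bound:
  assumes "T\<^sup>2 \<le> k n0"
  shows "T * card (A \<inter> {1..n}) \<le> T * n0 + 2 * n"
proof -
  define N where "N a = (+) a ` fresh a" for a
  define A' where "A' = A \<inter> {n0<..n}"
  have card_N: "T \<le> card (N a)" if "a \<in> A'" for a
  proof -
    have "T\<^sup>2 \<le> k a" using assms k_mono[of n0 a] that by (simp add: A'_def)
    also have "\<dots> \<le> (card (fresh a))\<^sup>2" using that mem_A_iff by (simp add: A'_def)
    finally have "T \<le> card (fresh a)" by simp
    then show ?thesis by (simp add: N_def card_image)
  qed
  have disj: "N a \<inter> N a' = {}" if "a \<in> A'" "a' \<in> A'" "a < a'" for a a'
  proof -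
    have "x \<in> (A \<inter> {..<a'}) + B" if "x \<in> N a" for x
      using that \<open>a \<in> A'\<close> \<open>a < a'\<close> by (auto simp: N_def fresh_def A'_def)
    moreover have "x \<notin> (A \<inter> {..<a'}) + B" if "x \<in> N a'" for x
      using that by (auto simp: N_def fresh_def)
    ultimately show ?thesis by blast
  qed
  have "T * card A' = (\<Sum>a\<in>A'. T)" by simp
  also have "\<dots> \<le> (\<Sum>a\<in>A'. card (N a))" by (intro sum_mono card_N)
  also have "\<dots> = card (\<Union> (N ` A'))"
  proof (rule card_UN_disjoint[symmetric])
    show "\<forall>i\<in>A'. \<forall>j\<in>A'. i \<noteq> j \<longrightarrow> N i \<inter> N j = {}"
      using disj by (metis Int_commute linorder_neqE_nat)
  qed (auto simp: A'_def N_def)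
  also have "\<dots> \<le> card {1..2 * n}"
    by (intro card_mono) (use B_pos in \<open>auto simp: N_def fresh_def A'_def\<close>)
  finally have *: "T * card A' \<le> 2 * n" by simp
  have "A \<inter> {1..n} \<subseteq> {1..n0} \<union> A'" by (auto simp: A'_def)
  then have "card (A \<inter> {1..n}) \<le> card ({1..n0} \<union> A')"
    by (intro card_mono) (auto simp: A'_def)
  also have "\<dots> \<le> n0 + card A'" using card_Un_le[of "{1..n0}" A'] by simp
  finally have "T * card (A \<inter> {1..n}) \<le> T * (n0 + card A')" by simp
  then show ?thesis using * by (simp add: algebra_simps)
qed

lemma card_A_small:
  assumes "e > 0"
  shows "\<forall>\<^sub>F n in sequentially. real (card (A \<inter> {1..n})) \<le> e * real n"
proof -
  obtain T :: nat where T: "4 / e < real T" using reals_Archimedean2 by blast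
  then have T0: "real T > 0" using assms by (meson divide_pos_pos less_trans zero_less_numeral)
  obtain n0 where n0: "T\<^sup>2 \<le> k n0"
    using k_at_top unfolding filterlim_at_top eventually_sequentially by blast
  \<comment> \<open>Once \<open>n >= T * n0\<close>, the bound \<open>T * n0 + 2 * n\<close> is at
    most \<open>3 * n\<close>.\<close>
  show ?thesis
    using eventually_ge_at_top[of "T * n0"]
  proof eventually_elim
    case (elim n)
    have "T * card (A \<inter> {1..n}) \<le> 3 * n"
      using card_A_bound[OF n0, of n] elim by simp
    then have "real T * real (card (A \<inter> {1..n})) \<le> 3 * real n"
      by (metis of_nat_le_iff of_nat_mult of_nat_numeral)
    also have "3 * real n \<le> real T * e * real n"
      using T assms by (intro mult_right_mono) (auto simp: field_simps)
    finally have "real T * real (card (A \<inter> {1..n})) \<le> real T * (e * real n)"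
      by (simp add: mult.assoc)
    then show ?case using T0 by simp
  qed
qed

section \<open>Upper bound for the sumset\<close>

lemma f_upper:
  assumes "d \<ge> 1"
  shows "\<forall>\<^sub>F n in sequentially. real (f n) \<le> \<alpha> * real n + 2 / real d * real n"
proof -
  obtain C where C: "\<And>n. card (B \<inter> {n div d<..n}) \<le> C" using window[OF assms] by blast
  \<comment> \<open>Chosen so that \<open>card (A \<inter> {1..n}) * C\<close> is at most
    \<open>n / d\<close>; \<open>C + 1\<close> guards against \<open>C = 0\<close>.\<close>
  have "\<forall>\<^sub>F n in sequentially. real (card (A \<inter> {1..n})) \<le> 1 / (real d * (real C + 1)) * real n"
    by (rule card_A_small) (use assms in auto)
  then show ?thesis
  proof eventually_elim
    case (elim n)
    \<comment> \<open>Adding 0 makes \<open>M\<close> nonempty; there \<open>f 0 = 0\<close>, so the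
      weak inequality for \<open>m\<close> survives.\<close>
    define M where "M = {m. m \<le> n \<and> (m = 0 \<or> real (f m) < \<alpha> * real m)}"
    define m where "m = Max M"
    have "finite M" "M \<noteq> {}" by (auto simp: M_def)
    then have "m \<in> M" and m_max: "\<And>a. a \<in> M \<Longrightarrow> a \<le> m" by (auto simp: m_def)
    have m: "m \<le> n" "real (f m) \<le> \<alpha> * real m" using \<open>m \<in> M\<close> by (auto simp: M_def f_def)
    have A_le: "a \<le> m" if "a \<in> A" "a \<le> n" for a
      using m_max[of a] that mem_A_iff by (simp add: M_def)
    \<comment> \<open>No element of \<open>A\<close> lies in \<open>{m<..n}\<close>, so a second
      summand up to \<open>n div d\<close> keeps the sum within \<open>m + n div d\<close>.\<close>
    have "(A + B) \<inter> {m<..n} \<subseteq> {m<..m + n div d} \<union> ((A \<inter> {1..n}) + (B \<inter> {n div d<..n}))"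
    proof
      fix x assume x: "x \<in> (A + B) \<inter> {m<..n}"
      then obtain y z where yz: "y \<in> A" "z \<in> B" "x = y + z" by (auto elim: set_plus_elim)
      have "y \<le> m" using A_le[of y] yz x by simp
      moreover have "y \<ge> 1" using A_pos yz by auto
      ultimately show "x \<in> {m<..m + n div d} \<union> ((A \<inter> {1..n}) + (B \<inter> {n div d<..n}))"
        using x yz by (cases "z \<le> n div d") (auto intro!: set_plus_intro)
    qed
    then have "card ((A + B) \<inter> {m<..n})
        \<le> card ({m<..m + n div d} \<union> ((A \<inter> {1..n}) + (B \<inter> {n div d<..n})))"
      by (intro card_mono) (auto intro!: finite_set_plus)
    also have "\<dots> \<le> n div d + card (A \<inter> {1..n}) * card (B \<inter> {n div d<..n})"
      using card_Un_le[of "{m<..m + n div d}" "(A \<inter> {1..n}) + (B \<inter> {n div d<..n})"]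
        card_set_plus_le[of "A \<inter> {1..n}" "B \<inter> {n div d<..n}"] by simp
    also have "\<dots> \<le> n div d + card (A \<inter> {1..n}) * C"
      using C[of n] by simp
    finally have "f n \<le> f m + n div d + card (A \<inter> {1..n}) * C"
      using card_Int_split[OF m(1), of "A + B"] by (simp add: f_def)
    then have "real (f n) \<le> real (f m) + real (n div d) + real (card (A \<inter> {1..n})) * real C"
      by (metis of_nat_le_iff of_nat_add of_nat_mult)
    moreover have "real (n div d) \<le> 1 / real d * real n"
      using of_nat_div_le_of_nat[of n d] by simp
    moreover have "real (card (A \<inter> {1..n})) * real C \<le> 1 / real d * real n"
    proof -
      have "real (card (A \<inter> {1..n})) * real C \<le> real (card (A \<inter> {1..n})) * (real C + 1)"
        by (intro mult_left_mono) auto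
      also have "\<dots> \<le> 1 / (real d * (real C + 1)) * real n * (real C + 1)"
        using elim by (intro mult_right_mono) auto
      also have "\<dots> = 1 / real d * real n"
      proof -
        have "real C + 1 \<noteq> 0" by linarith
        then show ?thesis by (simp add: divide_simps)
      qed
      finally show ?thesis .
    qed
    moreover have "\<alpha> * real m \<le> \<alpha> * real n" using m(1) \<alpha> by (simp add: mult_left_mono)
    moreover have "2 / real d * real n = 2 * (1 / real d * real n)" by simp
    ultimately show ?case using m(2) by linarith
  qed
qed

section \<open>Lower bound for the sumset\<close>

text \<open>Double counting: an uncovered \<open>x\<close> and \<open>b <= D\<close> give the pair
  \<open>(x - b, b)\<close>. The margin \<open>2 * D\<close> ensures both \<open>x - b > m\<close>
  and \<open>b <= x - b\<close>. Such an \<open>x - b\<close> is not in \<open>A\<close>, and being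
  rejected despite a thin sumset it has at most sqrt (k n) such \<open>b\<close>.\<close>

lemma card_uncovered_bound:
  assumes below: "\<And>a. m < a \<Longrightarrow> a \<le> n \<Longrightarrow> real (f a) < \<alpha> * real a"
  shows "real (card ({m + 2 * D<..n} - (A + B))) * real (k D) \<le> real n * sqrt (real (k n))"
proof -
  define U where "U = {m + 2 * D<..n} - (A + B)"
  define V where "V a = {b \<in> B. b \<le> a \<and> a + b \<notin> A + B}" for a
  have fin_V [simp]: "finite (V a)" for a
    by (rule finite_subset[of _ "{..a}"]) (auto simp: V_def)
  have V: "real (card (V a)) \<le> sqrt (real (k n))" if "a \<in> {m<..n}" for a
  proof (cases "a \<in> A")
    case True
    then have "V a = {}" by (auto simp: V_def)
    then show ?thesis by simp
  next
    case False
    have "V a \<subseteq> fresh a" by (auto simp: V_def fresh_def elim!: set_plus_elim)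
    then have "card (V a) \<le> card (fresh a)" by (simp add: card_mono)
    then have "(card (V a))\<^sup>2 \<le> (card (fresh a))\<^sup>2" by (simp add: power_mono)
    also have "\<dots> \<le> k a" using False below[of a] that mem_A_iff[of a] by simp
    also have "\<dots> \<le> k n" using that by (intro k_mono) simp
    finally show ?thesis by (simp add: real_le_rsqrt flip: of_nat_power)
  qed
  have "card U * k D = card (U \<times> (B \<inter> {1..D}))" by (simp add: k_def card_cartesian_product)
  also have "\<dots> \<le> card (Sigma {m<..n} V)"
  proof (rule card_inj_on_le)
    show "inj_on (\<lambda>(x, b). (x - b, b)) (U \<times> (B \<inter> {1..D}))"
      by (auto simp: inj_on_def U_def)
    show "(\<lambda>(x, b). (x - b, b)) ` (U \<times> (B \<inter> {1..D})) \<subseteq> Sigma {m<..n} V"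
      by (auto simp: U_def V_def)
  qed auto
  also have "\<dots> = (\<Sum>a\<in>{m<..n}. card (V a))" by simp
  finally have "real (card U * k D) \<le> (\<Sum>a\<in>{m<..n}. real (card (V a)))"
    unfolding of_nat_sum[symmetric] by (rule of_nat_mono)
  also have "\<dots> \<le> (\<Sum>a\<in>{m<..n}. sqrt (real (k n)))" by (intro sum_mono V)
  also have "\<dots> \<le> real n * sqrt (real (k n))" by (simp add: mult_right_mono)
  finally show ?thesis by (simp add: U_def)
qed

lemma f_lower:
  assumes "d \<ge> 1"
  shows "\<forall>\<^sub>F n in sequentially. \<alpha> * real n - 3 / real d * real n \<le> real (f n)"
proof -
  obtain C where C: "\<And>n. card (B \<inter> {n div d<..n}) \<le> C" using window[OF assms] by blast
  \<comment> \<open>The term \<open>2 * C\<close> will give \<open>k n <= 2 * k D\<close>; with it,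
    \<open>4 * d\<^sup>2\<close> gives \<open>d * sqrt (k n) <= k D\<close>.\<close>
  have "\<forall>\<^sub>F n in sequentially. 2 * C + 4 * d\<^sup>2 \<le> k n"
    using k_at_top unfolding filterlim_at_top by blast
  then show ?thesis
  proof eventually_elim
    case (elim n)
    define D where "D = n div d"
    define M where "M = {m. m \<le> n \<and> real (f m) \<ge> \<alpha> * real m}"
    define m where "m = Max M"
    have "finite M" "M \<noteq> {}" by (auto simp: M_def)
    then have "m \<in> M" and m_max: "\<And>a. a \<in> M \<Longrightarrow> a \<le> m" by (auto simp: m_def)
    then have m: "m \<le> n" "real (f m) \<ge> \<alpha> * real m" by (auto simp: M_def)
    define U where "U = {m + 2 * D<..n} - (A + B)"
    have U: "real (card U) * real (k D) \<le> real n * sqrt (real (k n))"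
      unfolding U_def
      by (rule card_uncovered_bound) (use m_max in \<open>force simp: M_def not_le\<close>)
    have "k n \<le> k D + C"
      using card_Int_split[of D n B] C[of n] by (simp add: k_def D_def)
    then have kD: "real (k n) \<le> 2 * real (k D)" using elim by simp
    have "4 * d\<^sup>2 \<le> k n" using elim by simp
    then have kn: "4 * (real d)\<^sup>2 \<le> real (k n)"
      by (metis of_nat_le_iff of_nat_mult of_nat_numeral of_nat_power)
    then have "sqrt (4 * (real d)\<^sup>2) \<le> sqrt (real (k n))" by simp
    then have d_le: "2 * real d \<le> sqrt (real (k n))" by (simp add: real_sqrt_mult)
    have kn_pos: "sqrt (real (k n)) > 0" using d_le assms by linarith
    have "2 * real d * sqrt (real (k n)) \<le> sqrt (real (k n)) * sqrt (real (k n))"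
      using d_le by (intro mult_right_mono) auto
    then have sqrt_le: "real d * sqrt (real (k n)) \<le> real (k D)"
      using kD by simp
    have "real (card U) * real d * sqrt (real (k n)) \<le> real (card U) * real (k D)"
      using sqrt_le by (simp add: mult_left_mono mult.assoc)
    also have "\<dots> \<le> real n * sqrt (real (k n))" by (rule U)
    finally have "real (card U) * real d \<le> real n"
      using kn_pos by simp
    then have cU: "real (card U) \<le> 1 / real d * real n"
      using assms by (simp add: field_simps)
    \<comment> \<open>Truncated subtraction is harmless: if \<open>m + 2 * D >= n\<close>, both
      sides are 0.\<close>
    have "n - m - 2 * D = card {m + 2 * D<..n}" by simp
    also have "\<dots> \<le> card (((A + B) \<inter> {m<..n}) \<union> U)"
      by (intro card_mono) (auto simp: U_def)
    also have "\<dots> \<le> card ((A + B) \<inter> {m<..n}) + card U" by (rule card_Un_le)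
    finally have "n - m - 2 * D \<le> card ((A + B) \<inter> {m<..n}) + card U" .
    then have "n + f m \<le> f n + card U + m + 2 * D"
      using card_Int_split[OF m(1), of "A + B"] by (simp add: f_def)
    then have "real n + real (f m) \<le> real (f n) + real (card U) + real m + 2 * real D"
      by linarith
    moreover have "real D \<le> 1 / real d * real n"
      using of_nat_div_le_of_nat[of n d] by (simp add: D_def)
    \<comment> \<open>Here \<open>\<alpha> <= 1\<close> enters: all but
      \<open>2 * D + card U\<close> points of \<open>{m<..n}\<close> are covered, a loss of at most
      \<open>3 * n / d\<close> against slope 1.\<close>
    moreover have "\<alpha> * real n - \<alpha> * real m \<le> real n - real m"
      using mult_left_le_one_le[of "real n - real m" \<alpha>] \<alpha> m(1) by (simp add: right_diff_distrib)
    moreover have "3 / real d * real n = 3 * (1 / real d * real n)" by simp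
    ultimately show ?case using m(2) cU by linarith
  qed
qed

section \<open>Both densities and the theorem\<close>

lemma density_A: "has_asymp_density A 0"
  by (rule has_asymp_densityI) (use card_A_small in simp)

lemma density_sumset: "has_asymp_density (A + B) \<alpha>"
proof (rule has_asymp_densityI)
  fix e :: real
  assume "e > 0"
  obtain d :: nat where d: "3 / e < real d" using reals_Archimedean2 by blast
  with \<open>e > 0\<close> have d0: "real d > 0" by (meson divide_pos_pos less_trans zero_less_numeral)
  then have d1: "d \<ge> 1" by simp
  have e: "3 / real d \<le> e" using d d0 \<open>e > 0\<close> by (simp add: field_simps)
  have e2: "2 / real d \<le> e" using e d0 by (simp add: field_simps)
  show "\<forall>\<^sub>F n in sequentially. \<bar>real (card ((A + B) \<inter> {1..n})) - \<alpha> * real n\<bar> \<le> e * real n"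
    using f_upper[OF d1] f_lower[OF d1]
  proof eventually_elim
    case (elim n)
    have "3 / real d * real n \<le> e * real n" "2 / real d * real n \<le> e * real n"
      using e e2 by (auto intro!: mult_right_mono simp del: times_divide_eq_left)
    then show ?case using elim unfolding f_def by linarith
  qed
qed

end

(* enumerate is 0-based: the n-th element b_n (n = 1, 2, ...) is enumerate B (n - 1);
   the shift does not affect the limit inferior, which is taken in the extended reals. *)
theorem theorem1p4:
  fixes B :: "nat set"
  assumes "B \<subseteq> {1..}"
    and "infinite B"
    and "\<exists>q\<ge>1. liminf (\<lambda>n. ereal (real (enumerate B (n + q)) / real (enumerate B n))) > 1"
  shows "\<forall>\<alpha>\<in>{0..1::real}. \<exists>A\<subseteq>{1..}.
           has_asymp_density A 0 \<and> has_asymp_density (A + B) \<alpha>"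
proof
  fix \<alpha> :: real
  assume \<alpha>: "\<alpha> \<in> {0..1}"
  obtain q where q: "liminf (\<lambda>n. ereal (real (enumerate B (n + q)) / real (enumerate B n))) > 1"
    using assms(3) by blast
  obtain A where A: "\<And>a. a \<in> A \<longleftrightarrow>
      real (card (((A \<inter> {..<a}) + B) \<inter> {1..a})) < \<alpha> * real a \<and>
      card (B \<inter> {1..a}) \<le> (card {b \<in> B. b \<le> a \<and> a + b \<notin> (A \<inter> {..<a}) + B})\<^sup>2"
    using greedy_set_exists[of "\<lambda>S a. real (card ((S + B) \<inter> {1..a})) < \<alpha> * real a \<and>
      card (B \<inter> {1..a}) \<le> (card {b \<in> B. b \<le> a \<and> a + b \<notin> S + B})\<^sup>2"] by blast
  interpret greedy A B \<alpha>
  proof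
    show "\<exists>C. \<forall>n. card (B \<inter> {n div d<..n}) \<le> C" if "d \<ge> 1" for d
      using card_window_bounded[OF assms(1,2) q that] .
    show "0 \<le> \<alpha>" "\<alpha> \<le> 1" using \<alpha> by simp_all
  qed (fact assms(1) assms(2) A)+
  show "\<exists>A\<subseteq>{1..}. has_asymp_density A 0 \<and> has_asymp_density (A + B) \<alpha>"
    using A_pos density_A density_sumset by blast
qed

end
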